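(* Let $R$ be a Noetherian local ring and let $d=\dim R$. Suppose that for every system of parameters $x_1,\ldots,x_d$ of $R$ and every positive integer $t$ the map $R/(x_1,\ldots,x_d)\to R/(x_1^t,\ldots,x_d^t)$ induced by multiplication by $(x_1\cdots x_d)^{t-1}$ is injective. Then $R$ is Cohen-Macaulay. *)

theory Defs
  imports "HOL-Algebra.Algebra" "HOL-Library.Extended_Nat"
begin

locale local_ring = cring R for R (structure) +
  assumes ex1_maximalideal: "\<exists>!M. maximalideal M R"

locale noetherian_local_ring = local_ring R + noetherian_ring R for R (structure)

definition max_ideal :: "('a, 'b) ring_scheme \<Rightarrow> 'a set" where
  "max_ideal R = (THE M. maximalideal M R)"

definition radical :: "('a, 'b) ring_scheme \<Rightarrow> 'a set \<Rightarrow> 'a set" where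
  "radical R I = {a \<in> carrier R. \<exists>n::nat. a [^]\<^bsub>R\<^esub> n \<in> I}"

definition prime_chain :: "('a, 'b) ring_scheme \<Rightarrow> nat \<Rightarrow> (nat \<Rightarrow> 'a set) \<Rightarrow> bool" where
  "prime_chain R n P \<longleftrightarrow> (\<forall>i\<le>n. primeideal (P i) R) \<and> (\<forall>i<n. P i \<subset> P (Suc i))"

definition krull_dim :: "('a, 'b) ring_scheme \<Rightarrow> enat" where
  "krull_dim R = Sup {enat n | n. \<exists>P. prime_chain R n P}"

text \<open>A finite sequence \<open>x\<^sub>1, \<dots>, x\<^sub>n\<close> is a function on \<open>nat\<close> of which only the values on
  \<open>{1..n}\<close> matter.\<close>

text \<open>For a local ring, \<open>radical R I = max_ideal R\<close> says that \<open>I\<close> is primary to the maximal ideal.\<close>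

definition system_of_parameters :: "('a, 'b) ring_scheme \<Rightarrow> nat \<Rightarrow> (nat \<Rightarrow> 'a) \<Rightarrow> bool" where
  "system_of_parameters R d x \<longleftrightarrow>
     krull_dim R = enat d \<and>
     x ` {1..d} \<subseteq> max_ideal R \<and>
     radical R (genideal R (x ` {1..d})) = max_ideal R"

definition nonzerodivisor :: "('a, 'b) ring_scheme \<Rightarrow> 'a \<Rightarrow> bool" where
  "nonzerodivisor R a \<longleftrightarrow>
     a \<in> carrier R \<and> (\<forall>b\<in>carrier R. a \<otimes>\<^bsub>R\<^esub> b = \<zero>\<^bsub>R\<^esub> \<longrightarrow> b = \<zero>\<^bsub>R\<^esub>)"

text \<open>In the zero ring every element is a nonzerodivisor; the last conjunct rules out that
  degenerate case.\<close>

definition regular_sequence :: "('a, 'b) ring_scheme \<Rightarrow> nat \<Rightarrow> (nat \<Rightarrow> 'a) \<Rightarrow> bool" where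
  "regular_sequence R n x \<longleftrightarrow>
     x ` {1..n} \<subseteq> carrier R \<and>
     (\<forall>i\<in>{1..n}. let I = genideal R (x ` {1..<i}) in nonzerodivisor (R Quot I) (I +>\<^bsub>R\<^esub> x i)) \<and>
     genideal R (x ` {1..n}) \<noteq> carrier R"

definition depth :: "('a, 'b) ring_scheme \<Rightarrow> enat" where
  "depth R = Sup {enat n | n. \<exists>x. regular_sequence R n x \<and> x ` {1..n} \<subseteq> max_ideal R}"

definition cohen_macaulay_local :: "('a, 'b) ring_scheme \<Rightarrow> bool" where
  "cohen_macaulay_local R \<longleftrightarrow> noetherian_local_ring R \<and> depth R = krull_dim R"

text \<open>The map \<open>R/I \<rightarrow> R/J\<close> induced by multiplication by \<open>y\<close>, written on cosets in the style of
  \<^const>\<open>rcoset_mult\<close>. It is meaningful when \<open>y I \<subseteq> J\<close>: the union is then over equal cosets.\<close>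

definition quot_mult_map ::
    "('a, 'b) ring_scheme \<Rightarrow> 'a set \<Rightarrow> 'a \<Rightarrow> 'a set \<Rightarrow> 'a set" where
  "quot_mult_map R J y C = (\<Union>c\<in>C. J +>\<^bsub>R\<^esub> (y \<otimes>\<^bsub>R\<^esub> c))"

lemma (in cring) quot_mult_map_rcoset:
  assumes I: "ideal I R" and J: "ideal J R" and y: "y \<in> carrier R" and r: "r \<in> carrier R"
    and IJ: "\<And>a. a \<in> I \<Longrightarrow> y \<otimes> a \<in> J"
  shows "quot_mult_map R J y (I +> r) = J +> (y \<otimes> r)"
proof -
  interpret I: ideal I R by fact
  interpret J: ideal J R by fact
  have "J +> (y \<otimes> c) = J +> (y \<otimes> r)" if "c \<in> I +> r" for c
  proof -
    from that obtain a where a: "a \<in> I" and c: "c = a \<oplus> r"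
      unfolding a_r_coset_def' by auto
    have "y \<otimes> c = y \<otimes> a \<oplus> y \<otimes> r"
      using c a y r I.Icarr by (simp add: r_distr)
    then have "y \<otimes> c \<in> J +> (y \<otimes> r)"
      using IJ[OF a] unfolding a_r_coset_def' by auto
    then show ?thesis
      using J.a_repr_independence' y r by simp
  qed
  moreover have "r \<in> I +> r" using r by (simp add: I.a_rcos_self)
  ultimately show ?thesis unfolding quot_mult_map_def by blast
qed

lemma (in cring) prod_pow_mult_genideal:
  fixes t d :: nat
  assumes x: "x ` {1..d} \<subseteq> carrier R" and t: "0 < t"
    and a: "a \<in> genideal R (x ` {1..d})"
  shows "(\<Otimes>i\<in>{1..d}. x i) [^] (t - 1) \<otimes> a \<in> genideal R ((\<lambda>i. x i [^] t) ` {1..d})"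
proof -
  define y where "y = (\<Otimes>i\<in>{1..d}. x i) [^] (t - 1)"
  define J where "J = genideal R ((\<lambda>i. x i [^] t) ` {1..d})"
  let ?K = "{a \<in> carrier R. y \<otimes> a \<in> J}"
  have xc: "x i \<in> carrier R" if "i \<in> {1..d}" for i using x that by blast
  have yc: "y \<in> carrier R" unfolding y_def using xc by (intro nat_pow_closed finprod_closed) auto
  have gens: "(\<lambda>i. x i [^] t) ` {1..d} \<subseteq> carrier R" using xc by auto
  interpret J: ideal J R unfolding J_def by (rule genideal_ideal[OF gens])
  have "ideal ?K R"
  proof (rule idealI[OF ring_axioms])
    show "subgroup ?K (add_monoid R)"
    proof (rule add.subgroupI)
      show "?K \<subseteq> carrier R" by auto
      show "?K \<noteq> {}" using yc by (auto intro!: exI[of _ \<zero>])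
    next
      fix b assume "b \<in> ?K"
      then show "\<ominus> b \<in> ?K" using yc by (auto simp: r_minus)
    next
      fix b c assume "b \<in> ?K" "c \<in> ?K"
      then show "b \<oplus> c \<in> ?K" using yc by (auto simp: r_distr)
    qed
  next
    fix b r assume b: "b \<in> ?K" and r: "r \<in> carrier R"
    have "y \<otimes> (r \<otimes> b) = r \<otimes> (y \<otimes> b)" using b r yc by (simp add: m_lcomm)
    then show "r \<otimes> b \<in> ?K" using b r by (auto simp: J.I_l_closed)
    have "y \<otimes> (b \<otimes> r) = (y \<otimes> b) \<otimes> r" using b r yc by (simp add: m_assoc)
    then show "b \<otimes> r \<in> ?K" using b r by (auto simp: J.I_r_closed)
  qed
  moreover have "x ` {1..d} \<subseteq> ?K"
  proof clarify
    fix i assume i: "i \<in> {1..d}"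
    let ?z = "\<Otimes>j\<in>{1..d} - {i}. x j"
    have zc: "?z \<in> carrier R" using xc by (intro finprod_closed) auto
    have split: "(\<Otimes>j\<in>{1..d}. x j) = x i \<otimes> ?z"
    proof -
      have "(\<Otimes>j\<in>insert i ({1..d} - {i}). x j) = x i \<otimes> ?z"
        using xc i by (intro finprod_insert) auto
      then show ?thesis using i by (simp add: insert_absorb)
    qed
    obtain s where s: "t = Suc s" using t gr0_implies_Suc by blast
    have "y = x i [^] s \<otimes> ?z [^] s"
      using split s xc[OF i] zc by (simp add: y_def nat_pow_distrib)
    then have "y \<otimes> x i = ?z [^] s \<otimes> x i [^] t"
      using s xc[OF i] zc by (simp add: m_ac)
    moreover have "x i [^] t \<in> J" unfolding J_def using genideal_self[OF gens] i by blast
    ultimately have "y \<otimes> x i \<in> J" using zc by (simp add: J.I_l_closed)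
    then show "x i \<in> carrier R \<and> y \<otimes> x i \<in> J" using xc[OF i] by simp
  qed
  ultimately have "genideal R (x ` {1..d}) \<subseteq> ?K" by (rule genideal_minimal)
  with a show ?thesis unfolding y_def J_def by blast
qed

end

theory Submission
  imports Defs
begin

text \<open>Write \<open>\<mm>\<close> for the maximal ideal. A system of parameters \<open>x\<^sub>1, \<dots>, x\<^sub>d\<close> exists, and under the
  injectivity hypothesis it is a regular sequence. Indeed, suppose
  \<open>x\<^bsub>i+1\<^esub> a \<in> (x\<^sub>1, \<dots>, x\<^sub>i)\<close>. For every \<open>n > 0\<close> the elements
  \<open>x\<^sub>1, \<dots>, x\<^sub>i, x\<^bsub>i+1\<^esub>\<^sup>n, \<dots>, x\<^sub>d\<^sup>n\<close> also form a system of parameters; let \<open>y\<close> be their product.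
  As \<open>x\<^bsub>i+1\<^esub>\<close> divides its own \<open>n\<close>-th power, \<open>y a\<close> lies in
  \<open>x\<^sub>1 \<cdots> x\<^sub>i (x\<^sub>1, \<dots>, x\<^sub>i)\<close>, hence in the ideal \<open>(x\<^sub>1\<^sup>2, \<dots>, x\<^sub>i\<^sup>2)\<close>, which is
  contained in the ideal generated by the squares of the new parameters. The hypothesis with
  \<open>t = 2\<close> therefore puts \<open>a\<close> into \<open>(x\<^sub>1, \<dots>, x\<^sub>i, x\<^bsub>i+1\<^esub>\<^sup>n, \<dots>, x\<^sub>d\<^sup>n)\<close>. Since \<open>n\<close> was
  arbitrary, Krull's intersection theorem gives \<open>a \<in> (x\<^sub>1, \<dots>, x\<^sub>i)\<close>. This argument is
  \<open>parameter_nonzerodivisor\<close>.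

  The rest is dimension theory. The intersection theorem is applied to one parameter at a time
  (\<open>Krull_intersection_principal\<close>, \<open>Krull_intersection_powers\<close>). Parameters are chosen by prime
  avoidance in such a way that each new one forces the primes above the sequence one step further up
  (\<open>ex_partial_parameters\<close>); a prime above all \<open>d\<close> of them then carries a chain of the maximal
  length \<open>d\<close> and must be \<open>\<mm>\<close>. The inequality \<open>depth R \<le> krull_dim R\<close> holds because a prime
  containing a regular sequence of length \<open>n\<close> lies above a chain of primes of length \<open>n\<close>
  (\<open>regular_sequence_prime_chain\<close>).\<close>

section \<open>Ideals of commutative rings\<close>

lemma (in cring) mem_Idl_insertE:
  assumes S: "S \<subseteq> carrier R" and a: "a \<in> carrier R" and c: "c \<in> Idl (insert a S)"
  obtains i r where "i \<in> Idl S" "r \<in> carrier R" "c = i \<oplus> r \<otimes> a"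
proof -
  interpret S: ideal "Idl S" R by (rule genideal_ideal[OF S])
  have J: "ideal (Idl S <+>\<^bsub>R\<^esub> PIdl a) R"
    by (intro add_ideals S.is_ideal cgenideal_ideal a)
  have "\<zero> \<oplus> a \<in> Idl S <+>\<^bsub>R\<^esub> PIdl a"
    using S.zero_closed cgenideal_self[OF a] unfolding set_add_def' by blast
  moreover have "s \<in> Idl S <+>\<^bsub>R\<^esub> PIdl a" if "s \<in> S" for s
  proof -
    have "s \<oplus> \<zero> \<in> Idl S <+>\<^bsub>R\<^esub> PIdl a"
      using genideal_self[OF S] that additive_subgroup.zero_closed[OF ideal.axioms(1)[OF cgenideal_ideal[OF a]]]
      unfolding set_add_def' by blast
    then show ?thesis using that S by auto
  qed
  ultimately have "Idl (insert a S) \<subseteq> Idl S <+>\<^bsub>R\<^esub> PIdl a"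
    using a by (intro genideal_minimal[OF J]) auto
  then obtain i p where "i \<in> Idl S" "p \<in> PIdl a" "c = i \<oplus> p"
    using c unfolding set_add_def' by blast
  then show thesis using that by (auto simp: cgenideal_def)
qed

lemma (in ring) Idl_of_ideal: "ideal I R \<Longrightarrow> Idl I = I"
  by (meson Idl_subset_ideal ideal.Icarr genideal_self subset_antisym subsetI)

lemma (in cring) mem_Idl_insert_idealE:
  assumes "ideal I R" "a \<in> carrier R" "c \<in> Idl (insert a I)"
  obtains i r where "i \<in> I" "r \<in> carrier R" "c = i \<oplus> r \<otimes> a"
  using mem_Idl_insertE[of I a c] assms Idl_of_ideal[OF assms(1)] ideal.Icarr[OF assms(1)]
  by (metis subsetI)

lemma (in primeideal) pow_mem_imp_mem:
  assumes "a \<in> carrier R" "a [^] (n::nat) \<in> I" shows "a \<in> I"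
  using assms(2)
proof (induction n)
  case 0
  then show ?case using one_imp_carrier I_notcarr by simp
next
  case (Suc n)
  then show ?case using I_prime[of "a [^] n" a] assms(1) by auto
qed

lemma (in ideal) mem_cancel_left:
  assumes "a \<in> I" "b \<in> carrier R" "a \<oplus> b \<in> I" shows "b \<in> I"
proof -
  have "\<ominus> a \<oplus> (a \<oplus> b) \<in> I" 
    by (rule additive_subgroup.a_closed[OF is_additive_subgroup
          additive_subgroup.a_inv_closed[OF is_additive_subgroup assms(1)] assms(3)])
  also have "\<ominus> a \<oplus> (a \<oplus> b) = b" using assms(2) a_Hcarr[OF assms(1)] by (rule r_neg1[rotated])
  finally show ?thesis .
qed

lemma (in ideal) mem_cancel_right:
  assumes "a \<in> I" "b \<in> carrier R" "b \<oplus> a \<in> I" shows "b \<in> I"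
  using mem_cancel_left[of a b] assms a_Hcarr a_comm by simp

section \<open>Prime ideals of Noetherian rings\<close>

locale noetherian_cring = cring R + noetherian_ring R for R (structure)

sublocale noetherian_local_ring \<subseteq> noetherian_cring ..

text \<open>The form in which the Noetherian property is used throughout: as \<open>Q\<close> is arbitrary, this is
  induction over ideals when \<open>Q\<close> is taken to be the failure of a claim.\<close>

lemma (in noetherian_ring) ex_maximal_ideal_with:
  assumes "ideal I R" "Q I"
  shows "\<exists>J. ideal J R \<and> I \<subseteq> J \<and> Q J \<and> (\<forall>K. ideal K R \<longrightarrow> J \<subseteq> K \<longrightarrow> Q K \<longrightarrow> K = J)"
proof -
  let ?A = "{J. ideal J R \<and> I \<subseteq> J \<and> Q J}"
  have "\<exists>M\<in>?A. \<forall>K\<in>?A. M \<subseteq> K \<longrightarrow> K = M"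
  proof (rule subset_Zorn_nonempty)
    show "?A \<noteq> {}" using assms by blast
    fix C assume C: "C \<noteq> {}" "subset.chain ?A C"
    then have "subset.chain {J. ideal J R} C" unfolding subset.chain_def by blast
    then have "\<Union>C \<in> C" using ideal_chain_is_trivial C(1) by blast
    then show "\<Union>C \<in> ?A" using C(2) unfolding subset.chain_def by blast
  qed
  then show ?thesis by (smt (verit) mem_Collect_eq subset_trans)
qed

lemma (in noetherian_ring) ideal_seq_stationary:
  fixes f :: "nat \<Rightarrow> 'a set"
  assumes "\<And>n. ideal (f n) R" "\<And>n. f n \<subseteq> f (Suc n)"
  obtains n where "f (Suc n) = f n"
proof -
  obtain J where J: "J \<in> range f" "\<And>K. ideal K R \<Longrightarrow> J \<subseteq> K \<Longrightarrow> K \<in> range f \<Longrightarrow> K = J"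
    using ex_maximal_ideal_with[of "f 0" "\<lambda>J. J \<in> range f"] assms(1) by (metis rangeI)
  then obtain n where "J = f n" by auto
  then show thesis using J(2)[of "f (Suc n)"] assms that by blast
qed

text \<open>An ideal maximal among those disjoint from a multiplicative set is prime: two elements outside
  it enlarge it to ideals that meet \<open>S\<close>, and the product of the two witnesses lies in \<open>S\<close> and would
  lie in the ideal if the product of the elements did.\<close>

lemma (in noetherian_cring) ex_prime_disjoint:
  assumes I: "ideal I R" and S: "S \<subseteq> carrier R" "\<one> \<in> S"
    and mult: "\<And>s t. s \<in> S \<Longrightarrow> t \<in> S \<Longrightarrow> s \<otimes> t \<in> S" and disj: "I \<inter> S = {}"
  obtains P where "primeideal P R" "I \<subseteq> P" "P \<inter> S = {}"
proof -
  obtain P where P: "ideal P R" "I \<subseteq> P" "P \<inter> S = {}"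
      and max: "\<And>K. ideal K R \<Longrightarrow> P \<subseteq> K \<Longrightarrow> K \<inter> S = {} \<Longrightarrow> K = P"
    using ex_maximal_ideal_with[of I "\<lambda>P. P \<inter> S = {}", OF I disj] by metis
  interpret P: ideal P R by fact
  have meets: "\<exists>p\<in>P. \<exists>r\<in>carrier R. p \<oplus> r \<otimes> a \<in> S" if "a \<in> carrier R" "a \<notin> P" for a
  proof -
    have sub: "insert a P \<subseteq> carrier R" using that P.a_subset by blast
    have "insert a P \<subseteq> Idl (insert a P)" by (rule genideal_self[OF sub])
    then have "Idl (insert a P) \<inter> S \<noteq> {}"
      using max[OF genideal_ideal[OF sub]] that by blast
    then show ?thesis by (metis P(1) disjoint_iff mem_Idl_insert_idealE that(1))
  qed
  have "primeideal P R"
  proof (rule primeidealI[OF P(1) is_cring])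
    show "carrier R \<noteq> P" using P(3) S by blast
  next
    fix a b assume ab: "a \<in> carrier R" "b \<in> carrier R" "a \<otimes> b \<in> P"
    show "a \<in> P \<or> b \<in> P"
    proof (rule ccontr)
      assume "\<not> (a \<in> P \<or> b \<in> P)"
      then obtain p r q s where 1: "p \<in> P" "r \<in> carrier R" "p \<oplus> r \<otimes> a \<in> S"
          "q \<in> P" "s \<in> carrier R" "q \<oplus> s \<otimes> b \<in> S"
        using meets ab by meson
      then have c: "p \<in> carrier R" "q \<in> carrier R" by auto
      have "(p \<oplus> r \<otimes> a) \<otimes> (q \<oplus> s \<otimes> b)
          = (q \<oplus> s \<otimes> b) \<otimes> p \<oplus> (r \<otimes> a) \<otimes> q \<oplus> (r \<otimes> s) \<otimes> (a \<otimes> b)"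
        using 1 c ab(1,2) by algebra
      also have "\<dots> \<in> P"
        using P.I_l_closed[OF 1(1), of "q \<oplus> s \<otimes> b"] P.I_l_closed[OF 1(4), of "r \<otimes> a"]
          P.I_l_closed[OF ab(3), of "r \<otimes> s"] 1 c ab(1,2)
        by (simp del: P.a_Hcarr)
      finally show False using mult[OF 1(3) 1(6)] P(3) by blast
    qed
  qed
  then show thesis using P that by blast
qed

text \<open>A substitute for the finiteness of the set of minimal primes over \<open>I\<close>. Noetherian induction
  suffices: if \<open>a b \<in> I\<close> with \<open>a, b \<notin> I\<close>, then every prime over \<open>I\<close> contains \<open>(I, a)\<close> or
  \<open>(I, b)\<close>, so the two finite sets for these larger ideals can be united. The members of \<open>F\<close> may
  fail to be minimal.\<close>

lemma (in noetherian_cring) finite_primes_below: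
  assumes "ideal I R"
  shows "\<exists>F. finite F \<and> (\<forall>P\<in>F. primeideal P R \<and> I \<subseteq> P) \<and>
           (\<forall>Q. primeideal Q R \<longrightarrow> I \<subseteq> Q \<longrightarrow> (\<exists>P\<in>F. P \<subseteq> Q))"
proof -
  define good where "good I \<longleftrightarrow> (\<exists>F. finite F \<and> (\<forall>P\<in>F. primeideal P R \<and> I \<subseteq> P) \<and>
           (\<forall>Q. primeideal Q R \<longrightarrow> I \<subseteq> Q \<longrightarrow> (\<exists>P\<in>F. P \<subseteq> Q)))" for I
  have "good I"
  proof (rule ccontr)
    assume bad: "\<not> good I"
    obtain J where J: "ideal J R" "\<not> good J"
        and max: "\<And>K. ideal K R \<Longrightarrow> J \<subseteq> K \<Longrightarrow> \<not> good K \<Longrightarrow> K = J"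
      using ex_maximal_ideal_with[of I "\<lambda>J. \<not> good J", OF assms bad] by metis
    interpret J: ideal J R by fact
    have "\<not> primeideal J R"
    proof
      assume "primeideal J R"
      then have "good J" unfolding good_def by (intro exI[of _ "{J}"]) auto
      then show False using J(2) by blast
    qed
    moreover have "carrier R \<noteq> J"
    proof
      assume "carrier R = J"
      then have "\<not> J \<subseteq> Q" if "primeideal Q R" for Q
        using that primeideal.I_notcarr[OF that] ideal.Icarr[OF primeideal.axioms(1)[OF that]] by blast
      then have "good J" unfolding good_def by (intro exI[of _ "{}"]) auto
      then show False using J(2) by blast
    qed
    ultimately obtain a b where ab: "a \<in> carrier R" "b \<in> carrier R" "a \<otimes> b \<in> J" "a \<notin> J" "b \<notin> J"
      using J.primeidealCD[OF is_cring] by blast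
    have good_insert: "good (Idl (insert c J)) \<and> J \<subseteq> Idl (insert c J) \<and> c \<in> Idl (insert c J)"
      if "c \<in> carrier R" "c \<notin> J" for c
    proof -
      have sub: "insert c J \<subseteq> carrier R" using that J.a_subset by blast
      have "insert c J \<subseteq> Idl (insert c J)" by (rule genideal_self[OF sub])
      then show ?thesis using max[OF genideal_ideal[OF sub]] that by blast
    qed
    let ?A = "Idl (insert a J)" and ?B = "Idl (insert b J)"
    obtain F where F: "finite F" "\<forall>P\<in>F. primeideal P R \<and> ?A \<subseteq> P"
        "\<forall>Q. primeideal Q R \<longrightarrow> ?A \<subseteq> Q \<longrightarrow> (\<exists>P\<in>F. P \<subseteq> Q)"
      using good_insert[OF ab(1,4)] unfolding good_def by blast
    obtain G where G: "finite G" "\<forall>P\<in>G. primeideal P R \<and> ?B \<subseteq> P"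
        "\<forall>Q. primeideal Q R \<longrightarrow> ?B \<subseteq> Q \<longrightarrow> (\<exists>P\<in>G. P \<subseteq> Q)"
      using good_insert[OF ab(2,5)] unfolding good_def by blast
    have "\<exists>P\<in>F \<union> G. P \<subseteq> Q" if Q: "primeideal Q R" "J \<subseteq> Q" for Q
    proof -
      interpret Q: primeideal Q R by fact
      have "a \<in> Q \<or> b \<in> Q" using Q.I_prime ab Q(2) by blast
      then show ?thesis
      proof
        assume "a \<in> Q"
        then have "?A \<subseteq> Q" using Q(2) by (intro genideal_minimal Q.is_ideal) auto
        then show ?thesis using F(3) Q(1) by blast
      next
        assume "b \<in> Q"
        then have "?B \<subseteq> Q" using Q(2) by (intro genideal_minimal Q.is_ideal) auto
        then show ?thesis using G(3) Q(1) by blast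
      qed
    qed
    moreover have "\<forall>P\<in>F \<union> G. primeideal P R \<and> J \<subseteq> P"
      using F(2) G(2) good_insert[OF ab(1,4)] good_insert[OF ab(2,5)] by (metis Un_iff subset_trans)
    ultimately have "good J"
      unfolding good_def using F(1) G(1) by (metis finite_UnI)
    then show False using J(2) by blast
  qed
  then show ?thesis unfolding good_def .
qed

text \<open>The witness is a product of one element of \<open>I - P\<close> for each \<open>I \<in> F\<close>.\<close>

lemma (in cring) ex_mem_ideals_notin_prime:
  assumes P: "primeideal P R" and fin: "finite F"
    and F: "\<And>I. I \<in> F \<Longrightarrow> ideal I R \<and> \<not> I \<subseteq> P"
  shows "\<exists>y\<in>carrier R. y \<notin> P \<and> (\<forall>I\<in>F. y \<in> I)"
  using fin F
proof (induction F rule: finite_induct)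
  case empty
  have "\<one> \<notin> P" using ideal.one_imp_carrier primeideal.axioms(1) primeideal.I_notcarr P by metis
  then show ?case by auto
next
  case (insert I F)
  then obtain y where y: "y \<in> carrier R" "y \<notin> P" "\<forall>I\<in>F. y \<in> I" by blast
  obtain z where z: "z \<in> I" "z \<notin> P" using insert.prems by blast
  interpret I: ideal I R using insert.prems by blast
  have zc: "z \<in> carrier R" using z by auto
  have "z \<otimes> y \<notin> P" using primeideal.I_prime[OF P] y z zc by blast
  moreover have "z \<otimes> y \<in> J" if "J \<in> F" for J
    using y(3) that insert.prems zc by (auto intro: ideal.I_l_closed)
  moreover have "z \<otimes> y \<in> I" using I.I_r_closed z y by blast
  ultimately show ?case using y zc by (intro bexI[of _ "z \<otimes> y"]) auto
qed

text \<open>Induction on \<open>F\<close>: an element \<open>x\<close> that avoids \<open>F\<close> but lies in the new prime \<open>P\<close> is corrected by an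
  element \<open>y\<close> of \<open>I\<close> outside \<open>P\<close> that lies in all those \<open>Q \<in> F\<close> which are not contained in \<open>P\<close>.
  Avoidance of the remaining \<open>Q \<subseteq> P\<close> then follows from avoidance of \<open>P\<close>.\<close>

lemma (in cring) prime_avoidance:
  assumes I: "ideal I R" and fin: "finite F"
    and F: "\<And>P. P \<in> F \<Longrightarrow> primeideal P R \<and> \<not> I \<subseteq> P"
  shows "\<exists>x\<in>I. \<forall>P\<in>F. x \<notin> P"
  using fin F
proof (induction F rule: finite_induct)
  case empty
  then show ?case using additive_subgroup.zero_closed[OF ideal.axioms(1)[OF I]] by blast
next
  case (insert P F)
  interpret I: ideal I R by fact
  interpret P: primeideal P R using insert.prems by blast
  obtain x where x: "x \<in> I" "\<forall>Q\<in>F. x \<notin> Q" using insert by blast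
  show ?case
  proof (cases "x \<in> P")
    case False
    then show ?thesis using x by blast
  next
    case True
    let ?G = "insert I {Q \<in> F. \<not> Q \<subseteq> P}"
    have G: "ideal J R \<and> \<not> J \<subseteq> P" if "J \<in> ?G" for J
      using that insert.prems[of P] insert.prems[of J] I primeideal.axioms(1)[of J R] by auto
    have "finite ?G" using insert.hyps(1) by simp
    from ex_mem_ideals_notin_prime[OF P.primeideal this G]
    obtain y where y: "y \<notin> P" "\<forall>J\<in>?G. y \<in> J" by blast
    have c: "x \<in> carrier R" "y \<in> carrier R" using x y by auto
    have nP: "x \<oplus> y \<notin> P" using P.mem_cancel_left True c y by blast
    have "x \<oplus> y \<notin> Q" if Q: "Q \<in> F" for Q
    proof (cases "Q \<subseteq> P")
      case True
      then show ?thesis using nP by blast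
    next
      case False
      have "ideal Q R" using insert.prems Q by (auto intro: primeideal.axioms(1))
      moreover have "y \<in> Q" using y False Q by blast
      ultimately show ?thesis using ideal.mem_cancel_right[of Q R y x] x c Q by blast
    qed
    then show ?thesis using nP x y I.a_closed by (intro bexI[of _ "x \<oplus> y"]) auto
  qed
qed

section \<open>The maximal ideal and the intersection theorem\<close>

context noetherian_local_ring
begin

lemma maximalideal_max_ideal: "maximalideal (max_ideal R) R"
  unfolding max_ideal_def by (rule theI'[OF ex1_maximalideal])

sublocale \<mm>: maximalideal "max_ideal R" R by (rule maximalideal_max_ideal)

lemma primeideal_max_ideal: "primeideal (max_ideal R) R"
  using maximalideal_prime[OF maximalideal_max_ideal] .

lemma proper_ideal_subset_max_ideal:
  assumes I: "ideal I R" "I \<noteq> carrier R"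
  shows "I \<subseteq> max_ideal R"
proof -
  obtain J where J: "ideal J R" "I \<subseteq> J" "J \<noteq> carrier R"
      and max: "\<And>K. ideal K R \<Longrightarrow> J \<subseteq> K \<Longrightarrow> K \<noteq> carrier R \<Longrightarrow> K = J"
    using ex_maximal_ideal_with[of I "\<lambda>J. J \<noteq> carrier R", OF I] by metis
  have "maximalideal J R"
    using J max by (intro maximalidealI) auto
  then have "J = max_ideal R"
    using ex1_maximalideal maximalideal_max_ideal by blast
  then show ?thesis using J by simp
qed

lemma primeideal_subset_max_ideal: "primeideal P R \<Longrightarrow> P \<subseteq> max_ideal R"
  using proper_ideal_subset_max_ideal primeideal.axioms(1) primeideal.I_notcarr by metis

lemma Units_if_notin_max_ideal:
  assumes "a \<in> carrier R" "a \<notin> max_ideal R"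
  shows "a \<in> Units R"
proof -
  have "PIdl a = carrier R"
    using proper_ideal_subset_max_ideal[OF cgenideal_ideal] cgenideal_self assms by blast
  then obtain r where "r \<in> carrier R" "\<one> = r \<otimes> a"
    using one_closed unfolding cgenideal_def by blast
  then show ?thesis using assms m_comm unfolding Units_def by force
qed

text \<open>This says that \<open>\<Inter>\<^sub>n (I + (y\<^sup>n)) = I\<close>. Let \<open>N\<close> be the intersection. The colon ideals \<open>(I : y\<^sup>n)\<close>
  become stationary at some \<open>c\<close>, and then every \<open>z \<in> N\<close> is congruent to \<open>y z'\<close> modulo \<open>I\<close> for some
  \<open>z' \<in> N\<close>: writing \<open>z \<equiv> y\<^bsup>c+1\<^esup> b\<close>, the element \<open>z' = y\<^sup>c b\<close> works, because comparison with
  \<open>z \<equiv> y\<^bsup>c+1+n\<^esup> b'\<close> shows \<open>b - y\<^sup>n b' \<in> (I : y\<^bsup>c+1\<^esup>) = (I : y\<^sup>c)\<close>. Now choose \<open>z \<in> N\<close>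
  with \<open>(I, z) \<supseteq> (I, a)\<close> maximal. As \<open>(I, z) \<subseteq> (I, z')\<close>, equality holds, so
  \<open>z' \<equiv> r z \<equiv> r y z'\<close>. Since \<open>1 - r y\<close> is a unit, \<open>z' \<in> I\<close>, hence \<open>z \<in> I\<close> and \<open>a \<in> I\<close>.\<close>

lemma Krull_intersection_principal:
  assumes I: "ideal I R" and y: "y \<in> max_ideal R" and a: "a \<in> carrier R"
    and inter: "\<And>n::nat. \<exists>b\<in>carrier R. a \<ominus> y [^] n \<otimes> b \<in> I"
  shows "a \<in> I"
proof -
  interpret I: ideal I R by fact
  have yc: "y \<in> carrier R" using y by auto
  define N where "N = {a \<in> carrier R. \<forall>n::nat. \<exists>b\<in>carrier R. a \<ominus> y [^] n \<otimes> b \<in> I}"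
  define colon where "colon n = {b \<in> carrier R. y [^] n \<otimes> b \<in> I}" for n :: nat
  have "ideal (colon n) R" for n
    unfolding colon_def by (rule I.helper_max_prime[OF is_cring]) (use yc in auto)
  moreover have "colon n \<subseteq> colon (Suc n)" for n
  proof
    fix b assume b: "b \<in> colon n"
    then have "y \<otimes> (y [^] n \<otimes> b) \<in> I" unfolding colon_def using I.I_l_closed yc by blast
    moreover have "y \<otimes> (y [^] n \<otimes> b) = y [^] Suc n \<otimes> b"
      using b yc unfolding colon_def by (simp add: m_ac)
    ultimately show "b \<in> colon (Suc n)" using b unfolding colon_def by simp
  qed
  ultimately obtain c where c: "colon (Suc c) = colon c"
    by (rule ideal_seq_stationary)
  have divisible: "\<exists>z'\<in>N. z \<ominus> y \<otimes> z' \<in> I" if z: "z \<in> N" for z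
  proof -
    have zc: "z \<in> carrier R" using z N_def by blast
    obtain b where b: "b \<in> carrier R" "z \<ominus> y [^] Suc c \<otimes> b \<in> I"
      using z unfolding N_def by blast
    have "\<exists>b''\<in>carrier R. y [^] c \<otimes> b \<ominus> y [^] n \<otimes> b'' \<in> I" for n :: nat
    proof -
      obtain b' where b': "b' \<in> carrier R" "z \<ominus> y [^] (Suc c + n) \<otimes> b' \<in> I"
        using z unfolding N_def by blast
      define p where "p = y [^] c"
      define q where "q = y [^] n"
      have pq: "p \<in> carrier R" "q \<in> carrier R" "y [^] Suc c = p \<otimes> y" "y [^] (Suc c + n) = p \<otimes> y \<otimes> q"
        unfolding p_def q_def using yc by (simp_all flip: nat_pow_mult add: m_ac)
      have "(z \<ominus> p \<otimes> y \<otimes> q \<otimes> b') \<ominus> (z \<ominus> p \<otimes> y \<otimes> b) \<in> I"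
        using b b' pq unfolding a_minus_def by auto
      also have "(z \<ominus> p \<otimes> y \<otimes> q \<otimes> b') \<ominus> (z \<ominus> p \<otimes> y \<otimes> b) = p \<otimes> y \<otimes> (b \<ominus> q \<otimes> b')"
        using zc pq(1,2) yc b(1) b'(1) by algebra
      finally have "b \<ominus> q \<otimes> b' \<in> colon (Suc c)"
        using b b' pq unfolding colon_def by simp
      then have "b \<ominus> q \<otimes> b' \<in> colon c" using c by simp
      then have "p \<otimes> (b \<ominus> q \<otimes> b') \<in> I" unfolding colon_def p_def by simp
      also have "p \<otimes> (b \<ominus> q \<otimes> b') = p \<otimes> b \<ominus> q \<otimes> (p \<otimes> b')"
        using pq(1,2) b(1) b'(1) by algebra
      finally show ?thesis unfolding p_def q_def using b' yc by auto
    qed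
    then have "y [^] c \<otimes> b \<in> N" unfolding N_def using yc b by auto
    moreover have "y \<otimes> (y [^] c \<otimes> b) = y [^] Suc c \<otimes> b" using yc b by (simp add: m_ac)
    ultimately show ?thesis using b(2) by metis
  qed
  have ext: "insert z I \<subseteq> carrier R" if "z \<in> carrier R" for z using that I.a_subset by blast
  have aN: "a \<in> N" using a inter unfolding N_def by blast
  obtain J where J: "Idl (insert a I) \<subseteq> J" "\<exists>z\<in>N. J = Idl (insert z I)"
    and max: "\<And>K. ideal K R \<Longrightarrow> J \<subseteq> K \<Longrightarrow> (\<exists>z\<in>N. K = Idl (insert z I)) \<Longrightarrow> K = J"
    using ex_maximal_ideal_with[of "Idl (insert a I)" "\<lambda>J. \<exists>z\<in>N. J = Idl (insert z I)"] 
      genideal_ideal[OF ext[OF a]] aN by metis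
  obtain z where z: "z \<in> N" "J = Idl (insert z I)" using J by blast
  obtain z' where z': "z' \<in> N" "z \<ominus> y \<otimes> z' \<in> I" using divisible z by blast
  have zc: "z \<in> carrier R" "z' \<in> carrier R" using z z' N_def by auto
  let ?K = "Idl (insert z' I)"
  interpret K: ideal ?K R by (rule genideal_ideal[OF ext[OF zc(2)]])
  have K: "I \<subseteq> ?K" "z' \<in> ?K" using genideal_self[OF ext[OF zc(2)]] by auto
  have "(z \<ominus> y \<otimes> z') \<oplus> y \<otimes> z' \<in> ?K"
    using K z' yc by (intro K.a_closed K.I_l_closed) auto
  also have "(z \<ominus> y \<otimes> z') \<oplus> y \<otimes> z' = z" using zc yc by algebra
  finally have "J \<subseteq> ?K"
    unfolding z(2) using K by (intro genideal_minimal K.is_ideal) auto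
  then have "?K = J" using max z' K.is_ideal by blast
  then have "z' \<in> Idl (insert z I)" using K z by simp
  then obtain i r where ir: "i \<in> I" "r \<in> carrier R" "z' = i \<oplus> r \<otimes> z"
    by (rule mem_Idl_insert_idealE[OF I zc(1)])
  have ic: "i \<in> carrier R" using ir by auto
  have unit: "\<one> \<ominus> r \<otimes> y \<in> Units R"
  proof (rule Units_if_notin_max_ideal)
    show "\<one> \<ominus> r \<otimes> y \<in> carrier R" using ir yc by auto
    show "\<one> \<ominus> r \<otimes> y \<notin> max_ideal R"
    proof
      assume "\<one> \<ominus> r \<otimes> y \<in> max_ideal R"
      then have "(\<one> \<ominus> r \<otimes> y) \<oplus> r \<otimes> y \<in> max_ideal R"
        using \<mm>.I_l_closed[OF y ir(2)] \<mm>.a_closed by blast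
      also have "(\<one> \<ominus> r \<otimes> y) \<oplus> r \<otimes> y = \<one>" using ir(2) yc by algebra
      finally show False using \<mm>.one_imp_carrier \<mm>.I_notcarr by simp
    qed
  qed
  have "i \<oplus> r \<otimes> (z \<ominus> y \<otimes> z') \<in> I"
    using ir z' by (intro I.a_closed I.I_l_closed) auto
  also have "i \<oplus> r \<otimes> (z \<ominus> y \<otimes> z') = (i \<oplus> r \<otimes> z) \<ominus> r \<otimes> y \<otimes> z'"
    using ic ir(2) zc yc by algebra
  also have "\<dots> = (\<one> \<ominus> r \<otimes> y) \<otimes> z'"
    unfolding ir(3)[symmetric] using ir(2) zc yc by algebra
  finally have "inv (\<one> \<ominus> r \<otimes> y) \<otimes> ((\<one> \<ominus> r \<otimes> y) \<otimes> z') \<in> I"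
    using I.I_l_closed unit by blast
  also have "inv (\<one> \<ominus> r \<otimes> y) \<otimes> ((\<one> \<ominus> r \<otimes> y) \<otimes> z') = z'"
    by (subst m_assoc[symmetric]) (use unit zc in auto)
  finally have "z' \<in> I" .
  then have "(z \<ominus> y \<otimes> z') \<oplus> y \<otimes> z' \<in> I"
    using z' yc by (intro I.a_closed I.I_l_closed) auto
  also have "(z \<ominus> y \<otimes> z') \<oplus> y \<otimes> z' = z" using zc yc by algebra
  finally have "J \<subseteq> I" unfolding z(2) by (intro genideal_minimal I) auto
  then show ?thesis using J genideal_self[OF ext[OF a]] by blast
qed

end

section \<open>Chains of primes and systems of parameters\<close>

lemma prime_chain_prefix: "prime_chain R n P \<Longrightarrow> k \<le> n \<Longrightarrow> prime_chain R k P"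
  unfolding prime_chain_def by auto

lemma prime_chain_mono:
  assumes "prime_chain R n P" "k \<le> n" shows "P k \<subseteq> P n"
  using assms(2,1)
proof (induction rule: inc_induct)
  case (step k)
  then show ?case unfolding prime_chain_def by blast
qed simp

lemma prime_chain_snoc:
  assumes "prime_chain R n P" "primeideal Q R" "P n \<subset> Q"
  shows "prime_chain R (Suc n) (P(Suc n := Q))"
  using assms unfolding prime_chain_def by (auto simp: le_Suc_eq less_Suc_eq)

lemma prime_chain_length_le:
  assumes "krull_dim R = enat d" "prime_chain R n P" shows "n \<le> d"
proof -
  have "enat n \<le> krull_dim R" unfolding krull_dim_def using assms(2) by (intro Sup_upper) blast
  then show ?thesis using assms(1) by simp
qed

context noetherian_local_ring
begin

lemma ex_prime_chain_dim:
  assumes "krull_dim R = enat d"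
  shows "\<exists>P. prime_chain R d P"
proof -
  let ?A = "{n. \<exists>P. prime_chain R n P}"
  have "prime_chain R 0 (\<lambda>_. max_ideal R)"
    unfolding prime_chain_def using primeideal_max_ideal by simp
  then have ne: "?A \<noteq> {}" by blast
  have fin: "finite ?A"
    by (rule finite_subset[of _ "{..d}"]) (use prime_chain_length_le[OF assms] in auto)
  have "krull_dim R \<le> enat (Max ?A)"
    unfolding krull_dim_def
  proof (rule Sup_least, clarify)
    fix n P assume "prime_chain R n P"
    then show "enat n \<le> enat (Max ?A)" using Max_ge[OF fin, of n] by auto
  qed
  moreover have "Max ?A \<in> ?A" by (rule Max_in[OF fin ne])
  ultimately obtain P where "prime_chain R (Max ?A) P" "d \<le> Max ?A" using assms by auto
  then show ?thesis using prime_chain_prefix by blast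
qed

text \<open>Given \<open>x\<^sub>1, \<dots>, x\<^sub>n\<close>, the next element is chosen in \<open>\<mm>\<close> outside finitely many primes
  \<open>P \<noteq> \<mm>\<close> which, together with \<open>\<mm>\<close> if necessary, lie below all primes over
  \<open>(x\<^sub>1, \<dots>, x\<^sub>n)\<close>. A prime that contains all \<open>n + 1\<close>
  elements then properly contains such a \<open>P\<close>, which prolongs the chain below \<open>P\<close>. The only
  exception is \<open>P = \<mm>\<close>, where an initial piece of a chain of maximal length \<open>d\<close> serves.\<close>

lemma ex_partial_parameters:
  assumes dim: "krull_dim R = enat d" and "n \<le> d"
  shows "\<exists>x. x ` {1..n} \<subseteq> max_ideal R \<and>
    (\<forall>Q. primeideal Q R \<longrightarrow> x ` {1..n} \<subseteq> Q \<longrightarrow> (\<exists>P. prime_chain R n P \<and> P n \<subseteq> Q))"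
  using assms(2)
proof (induction n)
  case 0
  have "\<exists>P. prime_chain R 0 P \<and> P 0 \<subseteq> Q" if "primeideal Q R" for Q
    by (rule exI[of _ "\<lambda>_. Q"]) (use that in \<open>simp add: prime_chain_def\<close>)
  then show ?case by simp
next
  case (Suc n)
  then obtain x where xm: "x ` {1..n} \<subseteq> max_ideal R"
    and xchain: "\<And>Q. primeideal Q R \<Longrightarrow> x ` {1..n} \<subseteq> Q \<Longrightarrow> \<exists>P. prime_chain R n P \<and> P n \<subseteq> Q"
    by (metis Suc_leD)
  have xc: "x ` {1..n} \<subseteq> carrier R" using xm \<mm>.a_subset by blast
  obtain F where F: "finite F" "\<And>P. P \<in> F \<Longrightarrow> primeideal P R \<and> Idl (x ` {1..n}) \<subseteq> P"
    "\<And>Q. primeideal Q R \<Longrightarrow> Idl (x ` {1..n}) \<subseteq> Q \<Longrightarrow> \<exists>P\<in>F. P \<subseteq> Q"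
    using finite_primes_below[OF genideal_ideal[OF xc]] by metis
  have "primeideal P R \<and> \<not> max_ideal R \<subseteq> P" if "P \<in> F - {max_ideal R}" for P
    using that F(2)[of P] primeideal_subset_max_ideal[of P] by blast
  then obtain z where z: "z \<in> max_ideal R" "\<And>P. P \<in> F - {max_ideal R} \<Longrightarrow> z \<notin> P"
    using prime_avoidance[OF \<mm>.is_ideal, of "F - {max_ideal R}"] F(1) by (metis finite_Diff)
  let ?x = "x(Suc n := z)"
  have img: "?x ` {1..Suc n} = insert z (x ` {1..n})"
    by (auto simp: atLeastAtMostSuc_conv image_iff)
  have "\<exists>P. prime_chain R (Suc n) P \<and> P (Suc n) \<subseteq> Q"
    if Q: "primeideal Q R" "?x ` {1..Suc n} \<subseteq> Q" for Q
  proof -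
    have "Idl (x ` {1..n}) \<subseteq> Q"
      using Q img by (intro genideal_minimal) (auto intro: primeideal.axioms(1))
    then obtain P where P: "P \<in> F" "P \<subseteq> Q" using F(3) Q by blast
    show ?thesis
    proof (cases "P = max_ideal R")
      case True
      obtain C where C: "prime_chain R d C" using ex_prime_chain_dim[OF dim] by blast
      have "C (Suc n) \<subseteq> C d" using prime_chain_mono[OF C] Suc.prems by blast
      also have "C d \<subseteq> max_ideal R"
        using C primeideal_subset_max_ideal unfolding prime_chain_def by blast
      finally show ?thesis using prime_chain_prefix[OF C Suc.prems] True P by blast
    next
      case False
      then have "P \<noteq> Q" using z(2)[of P] P Q(2) img by blast
      moreover obtain C where C: "prime_chain R n C" "C n \<subseteq> P"
        using xchain[of P] F(2)[OF P(1)] genideal_self[OF xc] by blast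
      ultimately have "prime_chain R (Suc n) (C(Suc n := Q))"
        using P(2) Q(1) by (intro prime_chain_snoc) auto
      then show ?thesis by (intro exI[of _ "C(Suc n := Q)"]) simp
    qed
  qed
  moreover have "?x ` {1..Suc n} \<subseteq> max_ideal R" using img xm z(1) by auto
  ultimately show ?case by blast
qed

lemma ex_parameters:
  assumes dim: "krull_dim R = enat d"
  shows "\<exists>x. x ` {1..d} \<subseteq> max_ideal R \<and>
    (\<forall>Q. primeideal Q R \<longrightarrow> x ` {1..d} \<subseteq> Q \<longrightarrow> Q = max_ideal R)"
proof -
  obtain x where xm: "x ` {1..d} \<subseteq> max_ideal R"
    and xchain: "\<And>Q. primeideal Q R \<Longrightarrow> x ` {1..d} \<subseteq> Q \<Longrightarrow> \<exists>P. prime_chain R d P \<and> P d \<subseteq> Q"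
    using ex_partial_parameters[OF dim order_refl] by blast
  have "Q = max_ideal R" if Q: "primeideal Q R" "x ` {1..d} \<subseteq> Q" for Q
  proof (rule ccontr)
    assume "Q \<noteq> max_ideal R"
    then have "Q \<subset> max_ideal R" using primeideal_subset_max_ideal Q(1) by blast
    moreover obtain P where "prime_chain R d P" "P d \<subseteq> Q" using xchain Q by blast
    ultimately have "prime_chain R (Suc d) (P(Suc d := max_ideal R))"
      using primeideal_max_ideal by (intro prime_chain_snoc) auto
    then show False using prime_chain_length_le[OF dim] by fastforce
  qed
  then show ?thesis using xm by blast
qed

text \<open>An element of \<open>\<mm>\<close> no power of which lies in \<open>(x\<^sub>1, \<dots>, x\<^sub>d)\<close> would be avoided by some prime over
  this ideal. Unlike the radical, the condition on primes visibly survives replacing each \<open>x\<^sub>i\<close> by a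
  positive power of itself.\<close>

lemma system_of_parametersI:
  assumes dim: "krull_dim R = enat d" and xm: "x ` {1..d} \<subseteq> max_ideal R"
    and only: "\<And>Q. primeideal Q R \<Longrightarrow> x ` {1..d} \<subseteq> Q \<Longrightarrow> Q = max_ideal R"
  shows "system_of_parameters R d x"
proof -
  let ?I = "Idl (x ` {1..d})"
  have xc: "x ` {1..d} \<subseteq> carrier R" using xm \<mm>.a_subset by blast
  have Im: "?I \<subseteq> max_ideal R" by (rule genideal_minimal[OF \<mm>.is_ideal xm])
  have "radical R ?I \<subseteq> max_ideal R"
    unfolding radical_def using Im primeideal.pow_mem_imp_mem[OF primeideal_max_ideal] by blast
  moreover have "a \<in> radical R ?I" if a: "a \<in> max_ideal R" for a
  proof (rule ccontr)
    have ac: "a \<in> carrier R" using a by auto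
    let ?S = "range (\<lambda>n::nat. a [^] n)"
    assume "a \<notin> radical R ?I"
    then have disj: "?I \<inter> ?S = {}" unfolding radical_def using ac by blast
    have one: "\<one> \<in> ?S" by (rule range_eqI[of _ _ 0]) simp
    have mult: "s \<otimes> t \<in> ?S" if "s \<in> ?S" "t \<in> ?S" for s t
      using that nat_pow_mult[OF ac] by auto
    obtain Q where Q: "primeideal Q R" "?I \<subseteq> Q" "Q \<inter> ?S = {}"
      by (rule ex_prime_disjoint[OF genideal_ideal[OF xc] _ one mult disj]) (use ac in auto)
    have "Q = max_ideal R" using only[OF Q(1)] Q(2) genideal_self[OF xc] by blast
    moreover have "a \<in> ?S" by (rule range_eqI[of _ _ 1]) (use ac in simp)
    ultimately show False using a Q(3) by blast
  qed
  ultimately show ?thesis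
    unfolding system_of_parameters_def using dim xm by blast
qed

end

section \<open>Regular sequences\<close>

lemma (in cring) nonzerodivisor_Quot_iff:
  assumes I: "ideal I R" and x: "x \<in> carrier R"
  shows "nonzerodivisor (R Quot I) (I +> x) \<longleftrightarrow> (\<forall>a\<in>carrier R. x \<otimes> a \<in> I \<longrightarrow> a \<in> I)"
proof -
  interpret I: ideal I R by fact
  have coset: "I +> a = I \<longleftrightarrow> a \<in> I" if "a \<in> carrier R" for a
    using that I.rcos_const_imp_mem a_rcos_zero[OF I] by blast
  have "carrier (R Quot I) = (\<lambda>a. I +> a) ` carrier R"
    unfolding FactRing_def A_RCOSETS_def' by auto
  then show ?thesis
    unfolding nonzerodivisor_def using x
    by (auto simp: FactRing_def I.rcoset_mult_add coset)
qed

lemma (in cring) inj_on_quot_mult_mapD: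
  assumes I: "ideal I R" and J: "ideal J R" and y: "y \<in> carrier R"
    and IJ: "\<And>a. a \<in> I \<Longrightarrow> y \<otimes> a \<in> J"
    and inj: "inj_on (quot_mult_map R J y) (carrier (R Quot I))"
    and a: "a \<in> carrier R" "y \<otimes> a \<in> J"
  shows "a \<in> I"
proof -
  interpret I: ideal I R by fact
  interpret J: ideal J R by fact
  have "quot_mult_map R J y (I +> a) = J"
    using quot_mult_map_rcoset[OF I J y a(1) IJ] a_rcos_zero[OF J a(2)] by simp
  also have "J = quot_mult_map R J y (I +> \<zero>)"
    using quot_mult_map_rcoset[OF I J y zero_closed IJ] a_rcos_zero[OF J J.zero_closed] y by simp
  finally have "I +> a = I +> \<zero>"
    by (rule inj_onD[OF inj]) (use a a_rcosetsI[OF I.a_subset] in \<open>auto simp: FactRing_def\<close>)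
  then show ?thesis
    using a_rcos_zero[OF I I.zero_closed] I.rcos_const_imp_mem a by simp
qed

text \<open>The inductive step needs a prime \<open>P \<subset> Q\<close> over \<open>I = (x\<^sub>1, \<dots>, x\<^sub>n)\<close> that does not contain
  \<open>y = x\<^bsub>n+1\<^esub>\<close>. It is found by avoiding the multiplicative set of all \<open>y\<^sup>k s\<close> with \<open>s \<notin> Q\<close>. This set
  is disjoint from \<open>I\<close>: as \<open>y\<close> is a nonzerodivisor modulo \<open>I\<close>, from \<open>y\<^sup>k s \<in> I\<close> it would follow that
  \<open>s \<in> I \<subseteq> Q\<close>.\<close>

lemma (in noetherian_cring) regular_sequence_prime_chain:
  assumes "x ` {1..n} \<subseteq> carrier R"
    and "\<And>i a. i \<in> {1..n} \<Longrightarrow> a \<in> carrier R \<Longrightarrow> x i \<otimes> a \<in> Idl (x ` {1..<i}) \<Longrightarrow> a \<in> Idl (x ` {1..<i})"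
    and "primeideal Q R" "x ` {1..n} \<subseteq> Q"
  shows "\<exists>P. prime_chain R n P \<and> P n \<subseteq> Q"
  using assms
proof (induction n arbitrary: Q)
  case 0
  show ?case
    by (rule exI[of _ "\<lambda>_. Q"]) (use 0 in \<open>simp add: prime_chain_def\<close>)
next
  case (Suc n)
  interpret Q: primeideal Q R by fact
  let ?y = "x (Suc n)" and ?I = "Idl (x ` {1..n})"
  have xc: "x ` {1..n} \<subseteq> carrier R" and yc: "?y \<in> carrier R" using Suc.prems(1) by auto
  have yQ: "?y \<in> Q" using Suc.prems(4) by auto
  interpret I: ideal ?I R by (rule genideal_ideal[OF xc])
  have "x ` {1..n} \<subseteq> Q" using Suc.prems(4) by fastforce
  then have IQ: "?I \<subseteq> Q" by (rule genideal_minimal[OF Q.is_ideal])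
  have nzd: "a \<in> ?I" if "a \<in> carrier R" "?y \<otimes> a \<in> ?I" for a
    using Suc.prems(2)[of "Suc n" a] that by (simp add: atLeastLessThanSuc_atLeastAtMost)
  have nzd_pow: "a \<in> ?I" if "a \<in> carrier R" "?y [^] k \<otimes> a \<in> ?I" for k :: nat and a
    using that(2)
  proof (induction k)
    case 0
    then show ?case using that(1) by simp
  next
    case (Suc k)
    have "?y \<otimes> (?y [^] k \<otimes> a) \<in> ?I" using Suc.prems yc that(1) by (simp add: m_ac)
    from nzd[OF _ this] have "?y [^] k \<otimes> a \<in> ?I" using yc that(1) by simp
    then show ?case by (rule Suc.IH)
  qed
  let ?S = "{?y [^] k \<otimes> s | (k::nat) s. s \<in> carrier R - Q}"
  have oneQ: "\<one> \<notin> Q" using Q.one_imp_carrier Q.I_notcarr by blast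
  have S: "?S \<subseteq> carrier R" using yc by auto
  have one: "\<one> \<in> ?S"
    using oneQ by (intro CollectI exI[of _ 0] exI[of _ \<one>]) simp
  have mult: "s \<otimes> t \<in> ?S" if st: "s \<in> ?S" "t \<in> ?S" for s t
  proof -
    obtain k l :: nat and u v where
      uv: "s = ?y [^] k \<otimes> u" "t = ?y [^] l \<otimes> v" "u \<in> carrier R - Q" "v \<in> carrier R - Q"
      using st by blast
    have "s \<otimes> t = ?y [^] (k + l) \<otimes> (u \<otimes> v)"
      using uv yc by (simp add: m_ac flip: nat_pow_mult)
    moreover have "u \<otimes> v \<in> carrier R - Q" using uv Q.I_prime by blast
    ultimately show ?thesis by blast
  qed
  have disj: "?I \<inter> ?S = {}" using nzd_pow IQ by blast
  obtain P where P: "primeideal P R" "?I \<subseteq> P" "P \<inter> ?S = {}"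
    by (rule ex_prime_disjoint[OF I.is_ideal S one mult disj])
  have "s \<in> ?S" if "s \<in> carrier R - Q" for s
    using that by (intro CollectI exI[of _ 0] exI[of _ s]) simp
  then have "P \<subseteq> Q" using P(3) ideal.Icarr[OF primeideal.axioms(1)[OF P(1)]] by blast
  moreover have "?y \<in> ?S"
    using yc oneQ by (intro CollectI exI[of _ 1] exI[of _ \<one>]) simp
  then have "?y \<notin> P" using P(3) by blast
  ultimately have "P \<subset> Q" using yQ by blast
  moreover have "\<exists>C. prime_chain R n C \<and> C n \<subseteq> P"
  proof (rule Suc.IH[OF xc _ P(1)])
    show "x ` {1..n} \<subseteq> P" using P(2) genideal_self[OF xc] by blast
    fix i a assume "i \<in> {1..n}" "a \<in> carrier R" "x i \<otimes> a \<in> Idl (x ` {1..<i})"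
    then show "a \<in> Idl (x ` {1..<i})" using Suc.prems(2)[of i a] by simp
  qed
  ultimately obtain C where "prime_chain R n C" "C n \<subset> Q" by blast
  then have "prime_chain R (Suc n) (C(Suc n := Q))"
    using Q.primeideal by (intro prime_chain_snoc)
  then show ?case by (metis fun_upd_same subset_refl)
qed

context noetherian_local_ring
begin

lemma depth_le_krull_dim: "depth R \<le> krull_dim R"
  unfolding depth_def
proof (rule Sup_least, clarify)
  fix n x assume reg: "regular_sequence R n x" and xm: "x ` {1..n} \<subseteq> max_ideal R"
  have xc: "x ` {1..n} \<subseteq> carrier R" using xm \<mm>.a_subset by blast
  have "a \<in> Idl (x ` {1..<i})"
    if "i \<in> {1..n}" "a \<in> carrier R" "x i \<otimes> a \<in> Idl (x ` {1..<i})" for i a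
  proof -
    have "x ` {1..<i} \<subseteq> carrier R" using xc that(1) by fastforce
    then have "ideal (Idl (x ` {1..<i})) R" by (rule genideal_ideal)
    moreover have "x i \<in> carrier R" using xc that(1) by blast
    ultimately show ?thesis
      using reg that nonzerodivisor_Quot_iff[of "Idl (x ` {1..<i})" "x i"]
      unfolding regular_sequence_def Let_def by blast
  qed
  then obtain P where "prime_chain R n P"
    using regular_sequence_prime_chain[OF xc _ primeideal_max_ideal xm] by blast
  then show "enat n \<le> krull_dim R"
    unfolding krull_dim_def by (intro Sup_upper) blast
qed

text \<open>The powers of \<open>x\<^sub>d, x\<^bsub>d-1\<^esub>, \<dots>, x\<^bsub>i+1\<^esub>\<close> are removed one after the other. Removing the last
  power means intersecting over its exponent while the others stay fixed, which is why the exponents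
  must be allowed to vary independently.\<close>

lemma Krull_intersection_powers:
  fixes x :: "nat \<Rightarrow> 'a"
  assumes xm: "x ` {1..d} \<subseteq> max_ideal R" and a: "a \<in> carrier R" and "i \<le> d"
    and inter: "\<And>e :: nat \<Rightarrow> nat. (\<forall>j. 0 < e j) \<Longrightarrow> (\<forall>j\<le>i. e j = 1) \<Longrightarrow>
      a \<in> Idl ((\<lambda>j. x j [^] e j) ` {1..d})"
  shows "a \<in> Idl (x ` {1..i})"
proof -
  have xc: "x j \<in> carrier R" if "j \<in> {1..d}" for j using xm that \<mm>.a_subset by blast
  define admissible where "admissible e \<longleftrightarrow> (\<forall>j. 0 < e j) \<and> (\<forall>j\<le>i. e j = 1)"
    for e :: "nat \<Rightarrow> nat"
  have "\<forall>e. admissible e \<longrightarrow> a \<in> Idl ((\<lambda>j. x j [^] e j) ` {1..i})"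
    using \<open>i \<le> d\<close>
  proof (induction rule: inc_induct)
    case base
    then show ?case using inter unfolding admissible_def by blast
  next
    case (step k)
    show ?case
    proof (intro allI impI)
      fix e assume e: "admissible e"
      let ?S = "(\<lambda>j. x j [^] e j) ` {1..k}"
      have S: "?S \<subseteq> carrier R" using xc step.hyps by auto
      have y: "x (Suc k) \<in> max_ideal R" "x (Suc k) \<in> carrier R" using xm step.hyps xc by auto
      interpret I: ideal "Idl ?S" R by (rule genideal_ideal[OF S])
      have "\<exists>b\<in>carrier R. a \<ominus> x (Suc k) [^] n \<otimes> b \<in> Idl ?S" for n :: nat
      proof -
        \<comment> \<open>Exponents have to be positive, so \<open>n + 1\<close> is used in place of \<open>n\<close>.\<close>
        let ?e = "e(Suc k := Suc n)"
        have "admissible ?e" using e step.hyps unfolding admissible_def by auto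
        then have "a \<in> Idl ((\<lambda>j. x j [^] ?e j) ` {1..Suc k})" using step.IH by blast
        also have "(\<lambda>j. x j [^] ?e j) ` {1..Suc k} = insert (x (Suc k) [^] Suc n) ?S"
          by (auto simp: atLeastAtMostSuc_conv image_iff)
        finally obtain u r where ur: "u \<in> Idl ?S" "r \<in> carrier R" "a = u \<oplus> r \<otimes> x (Suc k) [^] Suc n"
          by (rule mem_Idl_insertE[OF S nat_pow_closed[OF y(2)]])
        define p where "p = x (Suc k) [^] n"
        have c: "p \<in> carrier R" "u \<in> carrier R" "x (Suc k) [^] Suc n = p \<otimes> x (Suc k)"
          unfolding p_def using ur y by auto
        have "a \<ominus> p \<otimes> (r \<otimes> x (Suc k)) = u"
          unfolding ur(3) c(3) using c(1,2) ur(2) y(2) by algebra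
        then show ?thesis unfolding p_def using ur y by (metis m_closed)
      qed
      then show "a \<in> Idl ?S" by (rule Krull_intersection_principal[OF I.is_ideal y(1) a])
    qed
  qed
  from this[rule_format, of "\<lambda>_. 1"]
  have "a \<in> Idl ((\<lambda>j. x j [^] (1::nat)) ` {1..i})" unfolding admissible_def by simp
  also have "(\<lambda>j. x j [^] (1::nat)) ` {1..i} = x ` {1..i}"
    by (rule image_cong) (use xc \<open>i \<le> d\<close> in auto)
  finally show ?thesis .
qed

text \<open>The argument for regularity: \<open>inj\<close>, the case \<open>t = 2\<close> of the injectivity condition, is applied
  to the powers \<open>x\<^sub>j\<close> to the \<open>e\<^sub>j\<close>, with \<open>e\<^sub>j = 1\<close> for \<open>j \<le> i\<close> so that the relation
  \<open>x\<^bsub>i+1\<^esub> a \<in> (x\<^sub>1, \<dots>, x\<^sub>i)\<close> is kept, and with arbitrary positive \<open>e\<^sub>j\<close> beyond, so that the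
  intersection theorem can remove these powers from the resulting ideal.\<close>

lemma parameter_nonzerodivisor:
  assumes dim: "krull_dim R = enat d"
    and xm: "x ` {1..d} \<subseteq> max_ideal R"
    and only: "\<And>Q. primeideal Q R \<Longrightarrow> x ` {1..d} \<subseteq> Q \<Longrightarrow> Q = max_ideal R"
    and inj: "\<And>y. system_of_parameters R d y \<Longrightarrow>
           inj_on (quot_mult_map R (Idl ((\<lambda>i. y i [^] (2::nat)) ` {1..d})) (\<Otimes>i\<in>{1..d}. y i))
             (carrier (R Quot (Idl (y ` {1..d}))))"
    and i: "Suc i \<le> d" and a: "a \<in> carrier R" "x (Suc i) \<otimes> a \<in> Idl (x ` {1..i})"
  shows "a \<in> Idl (x ` {1..i})"
proof (rule Krull_intersection_powers[OF xm a(1)])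
  show "i \<le> d" using i by simp
next
  fix e :: "nat \<Rightarrow> nat" assume e0: "\<forall>j. 0 < e j" and e1: "\<forall>j\<le>i. e j = 1"
  have xc: "x j \<in> carrier R" if "j \<in> {1..d}" for j using xm that \<mm>.a_subset by blast
  define y where "y j = x j [^] e j" for j
  have ym: "y j \<in> max_ideal R" if j: "j \<in> {1..d}" for j
  proof -
    obtain k where "e j = Suc k" using e0 gr0_implies_Suc by blast
    moreover have "x j \<in> max_ideal R" using xm j by blast
    ultimately show ?thesis
      using xc[OF j] \<mm>.I_l_closed[of "x j" "x j [^] k"] unfolding y_def by simp
  qed
  have yc: "y j \<in> carrier R" if "j \<in> {1..d}" for j using ym[OF that] by auto
  have yimg: "y ` {1..d} \<subseteq> carrier R" using yc by blast
  have sop: "system_of_parameters R d y"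
  proof (rule system_of_parametersI[OF dim])
    show "y ` {1..d} \<subseteq> max_ideal R" using ym by blast
    fix Q assume Q: "primeideal Q R" "y ` {1..d} \<subseteq> Q"
    have "x j \<in> Q" if "j \<in> {1..d}" for j
      using primeideal.pow_mem_imp_mem[OF Q(1) xc[OF that], of "e j"] Q(2) that
      unfolding y_def by blast
    then show "Q = max_ideal R" by (intro only[OF Q(1)]) blast
  qed
  let ?I = "Idl (y ` {1..d})" and ?J = "Idl ((\<lambda>j. y j [^] (2::nat)) ` {1..d})"
    and ?y = "\<Otimes>j\<in>{1..d}. y j"
  have sq: "(\<lambda>j. y j [^] (2::nat)) ` {1..d} \<subseteq> carrier R" using yc by auto
  interpret J: ideal ?J R by (rule genideal_ideal[OF sq])
  let ?u = "\<Otimes>j\<in>{1..i}. y j" and ?v = "\<Otimes>j\<in>{Suc (Suc i)..d}. y j"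
  have uc: "?u \<in> carrier R" and vc: "?v \<in> carrier R"
    using yc i by (auto intro!: finprod_closed)
  have yic: "y (Suc i) \<in> carrier R" using yc i by simp
  have "?y = (\<Otimes>j\<in>{1..i} \<union> {Suc i..d}. y j)"
    using i by (intro finprod_cong') (auto intro: yc)
  also have "\<dots> = ?u \<otimes> (\<Otimes>j\<in>{Suc i..d}. y j)"
    using yc i by (intro finprod_Un_disjoint) auto
  also have "{Suc i..d} = insert (Suc i) {Suc (Suc i)..d}" using i by auto
  also have "(\<Otimes>j\<in>\<dots>. y j) = y (Suc i) \<otimes> ?v"
    using yc i by (intro finprod_insert) auto
  finally have y_split: "?y = ?u \<otimes> (y (Suc i) \<otimes> ?v)" .
  obtain k where k: "e (Suc i) = Suc k" using e0 gr0_implies_Suc by blast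
  have xic: "x (Suc i) \<in> carrier R" using xc i by simp
  have ximg: "x ` {1..i} \<subseteq> carrier R" using xc i by auto
  have xy: "x ` {1..i} = y ` {1..i}"
    unfolding y_def by (rule image_cong) (use e1 xc i in auto)
  have yimg_i: "y ` {1..i} \<subseteq> carrier R" using ximg xy by simp
  have "x (Suc i) \<otimes> a \<in> Idl (y ` {1..i})" using a(2) xy by simp
  \<comment> \<open>Multiplication by \<open>y\<^sub>1 \<cdots> y\<^sub>i\<close> carries \<open>(y\<^sub>1, \<dots>, y\<^sub>i)\<close> into the ideal of the squares.\<close>
  then have "(\<Otimes>j\<in>{1..i}. y j) [^] (2 - 1 :: nat) \<otimes> (x (Suc i) \<otimes> a)
      \<in> Idl ((\<lambda>j. y j [^] (2::nat)) ` {1..i})"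
    by (intro prod_pow_mult_genideal yimg_i) simp_all
  then have "?u \<otimes> (x (Suc i) \<otimes> a) \<in> Idl ((\<lambda>j. y j [^] (2::nat)) ` {1..i})"
    using uc by simp
  also have "Idl ((\<lambda>j. y j [^] (2::nat)) ` {1..i}) \<subseteq> ?J"
    using i genideal_self[OF sq] by (intro genideal_minimal J.is_ideal) auto
  finally have "(x (Suc i) [^] k \<otimes> ?v) \<otimes> (?u \<otimes> (x (Suc i) \<otimes> a)) \<in> ?J"
    using xic vc by (rule J.I_l_closed[OF _ m_closed[OF nat_pow_closed]])
  also have "(x (Suc i) [^] k \<otimes> ?v) \<otimes> (?u \<otimes> (x (Suc i) \<otimes> a)) = ?y \<otimes> a"
    unfolding y_split y_def[of "Suc i"] k using xic vc uc a(1) by (simp add: m_ac)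
  finally have "?y \<otimes> a \<in> ?J" .
  moreover have "?y \<otimes> b \<in> ?J" if "b \<in> ?I" for b
    using prod_pow_mult_genideal[OF yimg _ that, of 2] yc by (simp add: finprod_closed Pi_def)
  ultimately have "a \<in> ?I"
    using yc by (intro inj_on_quot_mult_mapD[OF genideal_ideal[OF yimg] J.is_ideal _ _ inj[OF sop] a(1)])
      (auto intro!: finprod_closed)
  then show "a \<in> Idl ((\<lambda>j. x j [^] e j) ` {1..d})" unfolding y_def .
qed

end

theorem proposition6p3:
  fixes R :: "('a, 'b) ring_scheme" (structure) and d :: nat
  assumes "noetherian_local_ring R"
    and "krull_dim R = enat d"
    and "\<And>(x :: nat \<Rightarrow> 'a) (t :: nat). system_of_parameters R d x \<Longrightarrow> 0 < t \<Longrightarrow>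
           inj_on
             (quot_mult_map R (Idl ((\<lambda>i. x i [^] t) ` {1..d})) ((\<Otimes>i\<in>{1..d}. x i) [^] (t - 1)))
             (carrier (R Quot (Idl (x ` {1..d}))))"
  shows "cohen_macaulay_local R"
proof -
  interpret noetherian_local_ring R by fact
  obtain x where xm: "x ` {1..d} \<subseteq> max_ideal R"
    and only: "\<And>Q. primeideal Q R \<Longrightarrow> x ` {1..d} \<subseteq> Q \<Longrightarrow> Q = max_ideal R"
    using ex_parameters[OF assms(2)] by blast
  have xc: "x ` {1..d} \<subseteq> carrier R" using xm \<mm>.a_subset by blast
  have inj: "inj_on (quot_mult_map R (Idl ((\<lambda>i. y i [^] (2::nat)) ` {1..d})) (\<Otimes>i\<in>{1..d}. y i))
             (carrier (R Quot (Idl (y ` {1..d}))))" if y: "system_of_parameters R d y" for y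
  proof -
    have "y ` {1..d} \<subseteq> carrier R"
      using y \<mm>.a_subset unfolding system_of_parameters_def by blast
    then have "(\<Otimes>i\<in>{1..d}. y i) \<in> carrier R" by (intro finprod_closed) auto
    then show ?thesis using assms(3)[OF y, of 2] by simp
  qed
  have "nonzerodivisor (R Quot Idl (x ` {1..<i})) (Idl (x ` {1..<i}) +> x i)"
    if i: "i \<in> {1..d}" for i
  proof -
    obtain k where k: "i = Suc k" using i by (cases i) auto
    have "x ` {1..k} \<subseteq> carrier R" using xc i k by fastforce
    moreover have "x i \<in> carrier R" using xc i by blast
    moreover have "a \<in> Idl (x ` {1..k})"
      if "a \<in> carrier R" "x (Suc k) \<otimes> a \<in> Idl (x ` {1..k})" for a
      by (rule parameter_nonzerodivisor[OF assms(2) xm only inj _ that]) (use i k in auto)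
    ultimately show ?thesis
      using nonzerodivisor_Quot_iff[OF genideal_ideal] k
      by (simp add: atLeastLessThanSuc_atLeastAtMost)
  qed
  moreover have "Idl (x ` {1..d}) \<noteq> carrier R"
    using genideal_minimal[OF \<mm>.is_ideal xm] \<mm>.I_notcarr \<mm>.a_subset by blast
  ultimately have "regular_sequence R d x"
    unfolding regular_sequence_def Let_def using xc by blast
  then have "enat d \<le> depth R"
    unfolding depth_def using xm by (intro Sup_upper) blast
  then have "depth R = krull_dim R"
    using depth_le_krull_dim assms(2) by (intro antisym) simp_all
  then show ?thesis unfolding cohen_macaulay_local_def using assms(1) by blast
qed

end
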